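(* Let $g>0$, $\mu\ge0$, $M=\{\mu,-\mu\}$, and let $H$ be the operator on $l^2(\mathbf Z)$ given by $(Hf)_m=e^{-g}f_{m-1}+e^{g}f_{m+1}+V_mf_m$, where $V$ is a $(\mathbf Z,M)$ pseudo-ergodic potential. Then $0\in\mathrm{Spec}(H)$ if and only if $$e^g-e^{-g}\le\mu\le e^g+e^{-g}.$$
   Context: A potential $V:\mathbf Z\to M$ is $(\mathbf Z,M)$ pseudo-ergodic if for every $\varepsilon>0$, every finite $F\subset\mathbf Z$ and every $W:F\to M$ there is $k\in\mathbf Z$ with $|W_m-V_{m+k}|<\varepsilon$ for all $m\in F$. *)

theory Defs
  imports "HOL-Analysis.Analysis"
begin

definition l2 :: "('i \<Rightarrow> complex) set" where
  "l2 = {f. (\<lambda>m. (cmod (f m))\<^sup>2) summable_on UNIV}"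

definition l2_norm :: "('i \<Rightarrow> complex) \<Rightarrow> real" where
  "l2_norm f = sqrt (\<Sum>\<^sub>\<infinity>m. (cmod (f m))\<^sup>2)"

text \<open>Operators on \<open>l2\<close> are represented by functions on all sequences, of which
  only the restriction to \<open>l2\<close> matters.\<close>

definition l2_bounded_operator :: "(('i \<Rightarrow> complex) \<Rightarrow> ('i \<Rightarrow> complex)) \<Rightarrow> bool" where
  "l2_bounded_operator T \<longleftrightarrow>
     (\<forall>f\<in>l2. T f \<in> l2) \<and>
     (\<forall>f\<in>l2. \<forall>h\<in>l2. T (\<lambda>m. f m + h m) = (\<lambda>m. T f m + T h m)) \<and>
     (\<forall>c. \<forall>f\<in>l2. T (\<lambda>m. c * f m) = (\<lambda>m. c * T f m)) \<and>
     (\<exists>K. \<forall>f\<in>l2. l2_norm (T f) \<le> K * l2_norm f)"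

text \<open>The complement of the set of \<open>z\<close> for which \<open>T - z\<close> has a bounded two-sided inverse \<open>S\<close>
  on \<open>l2\<close>; intended for \<open>T\<close> with \<open>l2_bounded_operator T\<close>.\<close>

definition l2_spectrum :: "(('i \<Rightarrow> complex) \<Rightarrow> ('i \<Rightarrow> complex)) \<Rightarrow> complex set" where
  "l2_spectrum T =
     {z. \<not> (\<exists>S. l2_bounded_operator S \<and>
              (\<forall>f\<in>l2. S (\<lambda>m. T f m - z * f m) = f) \<and>
              (\<forall>f\<in>l2. (\<lambda>m. T (S f) m - z * S f m) = f))}"

definition pseudo_ergodic :: "complex set \<Rightarrow> (int \<Rightarrow> complex) \<Rightarrow> bool" where
  "pseudo_ergodic M V \<longleftrightarrow>
     range V \<subseteq> M \<and>
     (\<forall>\<epsilon>>0. \<forall>F W. finite F \<longrightarrow> W ` F \<subseteq> M \<longrightarrow>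
        (\<exists>k. \<forall>m\<in>F. cmod (W m - V (m + k)) < \<epsilon>))"

definition hopping :: "real \<Rightarrow> (int \<Rightarrow> complex) \<Rightarrow> (int \<Rightarrow> complex) \<Rightarrow> (int \<Rightarrow> complex)" where
  "hopping g V f =
     (\<lambda>m. of_real (exp (- g)) * f (m - 1) + of_real (exp g) * f (m + 1) + V m * f m)"

lemma l2_bounded_operator_hopping:
  assumes "bounded (range V)"
  shows "l2_bounded_operator (hopping g V)"
proof -
  obtain B where B: "\<And>m. cmod (V m) \<le> B"
    using assms by (auto simp: bounded_iff)
  define K where "K = 3 * (exp (- g))\<^sup>2 + 3 * (exp g)\<^sup>2 + 3 * B\<^sup>2"
  have main: "hopping g V f \<in> l2 \<and> l2_norm (hopping g V f) \<le> sqrt K * l2_norm f"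
    if f: "f \<in> l2" for f
  proof -
    define n where "n = (\<lambda>m. (cmod (f m))\<^sup>2)"
    have n: "n summable_on UNIV"
      using f by (simp add: l2_def n_def)
    have bij: "bij (\<lambda>m::int. m - 1)" "bij (\<lambda>m::int. m + 1)"
      by (rule bij_betw_byWitness[where f' = "\<lambda>m. m + 1"]; auto)
         (rule bij_betw_byWitness[where f' = "\<lambda>m. m - 1"]; auto)
    have sh: "(\<lambda>m. n (m - 1)) summable_on UNIV" "(\<lambda>m. n (m + 1)) summable_on UNIV"
      using n summable_on_reindex_bij_betw[OF bij(1), of n]
        summable_on_reindex_bij_betw[OF bij(2), of n] by auto
    have inf: "(\<Sum>\<^sub>\<infinity>m. n (m - 1)) = infsum n UNIV" "(\<Sum>\<^sub>\<infinity>m. n (m + 1)) = infsum n UNIV"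
      using infsum_reindex_bij_betw[OF bij(1), of n]
        infsum_reindex_bij_betw[OF bij(2), of n] by auto
    define r where "r = (\<lambda>m. 3 * (exp (- g))\<^sup>2 * n (m - 1) + 3 * (exp g)\<^sup>2 * n (m + 1) + 3 * B\<^sup>2 * n m)"
    have r: "r summable_on UNIV"
      unfolding r_def by (intro summable_on_add summable_on_cmult_right sh n)
    have r_sum: "infsum r UNIV = K * infsum n UNIV"
      unfolding r_def K_def
      by (subst infsum_add infsum_cmult_right; (intro summable_on_add summable_on_cmult_right sh n)?)+
         (simp add: inf algebra_simps)
    have le: "(cmod (hopping g V f m))\<^sup>2 \<le> r m" for m
    proof -
      have sq: "(x + y + z)\<^sup>2 \<le> 3 * x\<^sup>2 + 3 * y\<^sup>2 + 3 * z\<^sup>2" for x y z :: real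
        using sum_squares_ge_zero[of "x - y" "y - z"] zero_le_power2[of "x - z"]
        by (simp add: power2_eq_square algebra_simps)
      have "cmod (hopping g V f m) \<le>
          exp (- g) * cmod (f (m - 1)) + exp g * cmod (f (m + 1)) + B * cmod (f m)"
        unfolding hopping_def
        by (intro norm_triangle_le add_mono)
           (auto simp: norm_mult intro: mult_right_mono B)
      then have "(cmod (hopping g V f m))\<^sup>2 \<le>
          (exp (- g) * cmod (f (m - 1)) + exp g * cmod (f (m + 1)) + B * cmod (f m))\<^sup>2"
        by (rule power_mono) simp
      also have "\<dots> \<le> r m"
        using sq[of "exp (- g) * cmod (f (m - 1))" "exp g * cmod (f (m + 1))" "B * cmod (f m)"]
        by (simp add: r_def n_def power_mult_distrib)
      finally show ?thesis .
    qed
    have summ: "(\<lambda>m. (cmod (hopping g V f m))\<^sup>2) summable_on UNIV"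
      by (rule summable_on_comparison_test[OF r]) (use le in auto)
    have "(\<Sum>\<^sub>\<infinity>m. (cmod (hopping g V f m))\<^sup>2) \<le> K * infsum n UNIV"
      using infsum_mono[OF summ r le] r_sum by simp
    then have "l2_norm (hopping g V f) \<le> sqrt K * l2_norm f"
      unfolding l2_norm_def n_def by (metis real_sqrt_le_iff real_sqrt_mult)
    with summ show ?thesis by (simp add: l2_def)
  qed
  show ?thesis
    unfolding l2_bounded_operator_def
  proof (intro conjI ballI allI)
    show "\<exists>K. \<forall>f\<in>l2. l2_norm (hopping g V f) \<le> K * l2_norm f"
      using main by blast
  qed (use main in \<open>auto simp: hopping_def algebra_simps\<close>)
qed

end

theory Submission
  imports Defs
begin

text \<open>
  Outside the stated range of \<open>\<mu>\<close>, one of the three terms of \<open>hopping g V\<close> dominates the other two.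
  If \<open>\<mu> < exp g - exp (- g)\<close> it is the shift with weight \<open>exp g\<close>, and if
  \<open>\<mu> > exp g + exp (- g)\<close> it is the multiplication by \<open>V\<close>, which has constant modulus \<open>\<mu>\<close>.
  The dominant term is invertible, with an inverse whose norm is the reciprocal of its modulus, so
  the whole operator is inverted by a Neumann series
  (\<open>dominant_term_zero_notin_l2_spectrum\<close>). Since sequences are plain functions here, the
  series is summed pointwise; it solves the equation because the operators are local.

  Inside the range, suppose that 0 is not in the spectrum. Then \<open>hopping g V\<close> is bounded
  below. As \<open>V\<close> contains a copy of every finite pattern of signs, the same lower bound holds for
  \<open>hopping g W\<close> on finitely supported sequences, for every potential \<open>W\<close> with values
  \<open>\<plusminus>\<mu>\<close> (\<open>lower_bound_transfer\<close>). Such a bound excludes nonzero bounded solutions of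
  \<open>hopping g W f = 0\<close> (\<open>bounded_kernel_trivial\<close>): a truncation of \<open>f\<close> to \<open>[-n, n]\<close> is
  mapped to something that lives only at the ends of the interval, so the mass of \<open>f\<close> in the
  interval is controlled by its mass at the ends.

  It remains to choose \<open>W\<close> so that a bounded solution exists (\<open>bounded_null_solution\<close>). If \<open>\<mu> = exp g + exp (- g)\<close>,
  the constant potential has the solution \<open>(-1)^m\<close>. If \<open>\<mu> < exp g + exp (- g)\<close>, every solution for the constant
  potential stays bounded towards \<open>+\<infinity>\<close>. Towards \<open>-\<infinity>\<close> the alternating potential is used:
  there the signs can be arranged so that the moduli satisfy
  \<open>exp g * \<bar>f (m + 1)\<bar> = \<mu> * \<bar>f m\<bar> + exp (- g) * \<bar>f (m - 1)\<bar>\<close>, which has the solution \<open>\<rho>^m\<close> with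
  \<open>\<rho> \<ge> 1\<close> exactly when \<open>\<mu> \<ge> exp g - exp (- g)\<close>. As the equation has second order, a potential
  that is alternating on the left and constant on the right admits a solution that is bounded on both sides.
\<close>

section \<open>Square-summable sequences\<close>

text \<open>
  Bounds on finite subsets characterise membership in \<open>l2\<close>. With \<open>L2_set_le_l2_norm\<close>, the
  converse, this reduces norm inequalities for infinite sequences to the corresponding inequalities for
  the finite Euclidean norm.
\<close>

lemma l2I:
  assumes "\<And>F. finite F \<Longrightarrow> L2_set (\<lambda>m. cmod (f m)) F \<le> B"
  shows "f \<in> l2" and "l2_norm f \<le> B"
proof -
  have B: "0 \<le> B" using assms[of "{}"] by simp
  have le: "(\<Sum>m\<in>F. (cmod (f m))\<^sup>2) \<le> B\<^sup>2" if "finite F" for F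
    using assms[OF that] unfolding L2_set_def by (rule sqrt_le_D)
  have summ: "(\<lambda>m. (cmod (f m))\<^sup>2) summable_on UNIV"
    by (rule nonneg_bdd_above_summable_on) (auto intro!: bdd_aboveI[where M = "B\<^sup>2"] le)
  then show "f \<in> l2" by (simp add: l2_def)
  have "(\<Sum>\<^sub>\<infinity>m. (cmod (f m))\<^sup>2) \<le> B\<^sup>2"
    by (rule infsum_le_finite_sums[OF summ]) (rule le)
  then show "l2_norm f \<le> B"
    unfolding l2_norm_def using B by (simp add: real_le_lsqrt)
qed

lemma l2_norm_nonneg: "0 \<le> l2_norm f"
  unfolding l2_norm_def by (auto intro: infsum_nonneg)

lemma L2_set_le_l2_norm:
  assumes "f \<in> l2"
  shows "L2_set (\<lambda>m. cmod (f m)) F \<le> l2_norm f"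
proof (cases "finite F")
  case True
  then show ?thesis
    using assms unfolding L2_set_def l2_norm_def l2_def
    by (auto intro!: real_sqrt_le_mono finite_sum_le_infsum)
qed (simp add: l2_norm_nonneg)

lemma cmod_le_l2_norm: "f \<in> l2 \<Longrightarrow> cmod (f m) \<le> l2_norm f"
  using L2_set_le_l2_norm[of f "{m}"] by simp

lemma l2_add:
  assumes "f \<in> l2" "h \<in> l2"
  shows "(\<lambda>m. f m + h m) \<in> l2" and "l2_norm (\<lambda>m. f m + h m) \<le> l2_norm f + l2_norm h"
proof -
  have le: "L2_set (\<lambda>m. cmod (f m + h m)) F \<le> l2_norm f + l2_norm h" for F
  proof -
    have "L2_set (\<lambda>m. cmod (f m + h m)) F \<le> L2_set (\<lambda>m. cmod (f m) + cmod (h m)) F"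
      by (intro L2_set_mono norm_triangle_ineq) auto
    also have "\<dots> \<le> L2_set (\<lambda>m. cmod (f m)) F + L2_set (\<lambda>m. cmod (h m)) F"
      by (rule L2_set_triangle_ineq)
    also have "\<dots> \<le> l2_norm f + l2_norm h"
      by (intro add_mono L2_set_le_l2_norm assms)
    finally show ?thesis .
  qed
  show "(\<lambda>m. f m + h m) \<in> l2" "l2_norm (\<lambda>m. f m + h m) \<le> l2_norm f + l2_norm h"
    by (rule l2I, rule le)+
qed

lemma l2_weighted_shift:
  fixes f :: "int \<Rightarrow> complex"
  assumes "f \<in> l2" and c: "\<And>m. cmod (c m) \<le> \<gamma>"
  shows "(\<lambda>m. c m * f (m + k)) \<in> l2" and "l2_norm (\<lambda>m. c m * f (m + k)) \<le> \<gamma> * l2_norm f"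
proof -
  have \<gamma>: "0 \<le> \<gamma>" using order_trans[OF norm_ge_zero c] .
  have le: "L2_set (\<lambda>m. cmod (c m * f (m + k))) F \<le> \<gamma> * l2_norm f" for F
  proof -
    have "L2_set (\<lambda>m. cmod (c m * f (m + k))) F \<le> L2_set (\<lambda>m. \<gamma> * cmod (f (m + k))) F"
      by (intro L2_set_mono) (auto simp: norm_mult intro!: mult_right_mono c)
    also have "\<dots> = \<gamma> * L2_set (\<lambda>m. cmod (f (m + k))) F"
      by (rule L2_set_right_distrib[OF \<gamma>, symmetric])
    also have "L2_set (\<lambda>m. cmod (f (m + k))) F = L2_set (\<lambda>m. cmod (f m)) ((\<lambda>m. m + k) ` F)"
      unfolding L2_set_def by (subst sum.reindex) (auto simp: inj_on_def)
    also have "\<gamma> * \<dots> \<le> \<gamma> * l2_norm f"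
      by (intro mult_left_mono L2_set_le_l2_norm assms \<gamma>)
    finally show ?thesis .
  qed
  show "(\<lambda>m. c m * f (m + k)) \<in> l2" "l2_norm (\<lambda>m. c m * f (m + k)) \<le> \<gamma> * l2_norm f"
    by (rule l2I, rule le)+
qed

lemma l2_norm_shift:
  fixes f :: "int \<Rightarrow> complex"
  shows "l2_norm (\<lambda>m. f (m - k)) = l2_norm f"
proof -
  have "bij (\<lambda>m::int. m - k)"
    by (rule bij_betw_byWitness[where f' = "\<lambda>m. m + k"]) auto
  from infsum_reindex_bij_betw[OF this, of "\<lambda>m. (cmod (f m))\<^sup>2"]
  show ?thesis by (simp add: l2_norm_def)
qed

lemma finite_support:
  assumes "finite F" and "\<And>m. m \<notin> F \<Longrightarrow> f m = 0"
  shows l2_finite_support: "f \<in> l2"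
    and l2_norm_finite_support: "l2_norm f = sqrt (\<Sum>m\<in>F. (cmod (f m))\<^sup>2)"
proof -
  have "(\<lambda>m. (cmod (f m))\<^sup>2) summable_on UNIV \<longleftrightarrow> (\<lambda>m. (cmod (f m))\<^sup>2) summable_on F"
    by (rule summable_on_cong_neutral) (use assms(2) in auto)
  with assms(1) show "f \<in> l2" by (simp add: l2_def)
  have "(\<Sum>\<^sub>\<infinity>m. (cmod (f m))\<^sup>2) = (\<Sum>\<^sub>\<infinity>m\<in>F. (cmod (f m))\<^sup>2)"
    by (rule infsum_cong_neutral) (use assms(2) in auto)
  with assms(1) show "l2_norm f = sqrt (\<Sum>m\<in>F. (cmod (f m))\<^sup>2)"
    by (simp add: l2_norm_def)
qed

text \<open>
  The form of completeness that Neumann series need: absolutely convergent series converge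
  pointwise to an element of \<open>l2\<close>, because on every finite set the norms of the partial sums are
  bounded by the sum of the norms.
\<close>

lemma l2_suminf:
  fixes x :: "nat \<Rightarrow> 'i \<Rightarrow> complex"
  assumes x: "\<And>n. x n \<in> l2" and summ: "summable (\<lambda>n. l2_norm (x n))"
  shows "summable (\<lambda>n. x n m)" and "(\<lambda>m. \<Sum>n. x n m) \<in> l2"
proof -
  show sm: "summable (\<lambda>n. x n m)" for m
    by (rule summable_comparison_test'[OF summ]) (rule cmod_le_l2_norm[OF x])
  have partial: "(\<lambda>m. \<Sum>n<N. x n m) \<in> l2 \<and> l2_norm (\<lambda>m. \<Sum>n<N. x n m) \<le> (\<Sum>n<N. l2_norm (x n))" for N
  proof (induction N)
    case 0
    show ?case using finite_support[of "{}" "\<lambda>_ :: 'i. 0"] by simp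
  next
    case (Suc N)
    then show ?case
      using l2_add[OF _ x, of "\<lambda>m. \<Sum>n<N. x n m" N] by auto
  qed
  show "(\<lambda>m. \<Sum>n. x n m) \<in> l2"
  proof (rule l2I(1))
    fix F :: "'i set"
    have "(\<lambda>N. L2_set (\<lambda>m. cmod (\<Sum>n<N. x n m)) F) \<longlonglongrightarrow> L2_set (\<lambda>m. cmod (\<Sum>n. x n m)) F"
      unfolding L2_set_def by (intro tendsto_intros summable_LIMSEQ sm)
    moreover have "L2_set (\<lambda>m. cmod (\<Sum>n<N. x n m)) F \<le> (\<Sum>n. l2_norm (x n))" for N
    proof -
      have "L2_set (\<lambda>m. cmod (\<Sum>n<N. x n m)) F \<le> (\<Sum>n<N. l2_norm (x n))"
        using L2_set_le_l2_norm partial order_trans by blast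
      also have "\<dots> \<le> (\<Sum>n. l2_norm (x n))"
        by (rule sum_le_suminf[OF summ]) (auto simp: l2_norm_nonneg)
      finally show ?thesis .
    qed
    ultimately show "L2_set (\<lambda>m. cmod (\<Sum>n. x n m)) F \<le> (\<Sum>n. l2_norm (x n))"
      by (intro LIMSEQ_le_const2) auto
  qed
qed

section \<open>Invertibility and lower bounds\<close>

text \<open>
  The lower bound makes \<open>T\<close> injective, so the solutions of \<open>T f = h\<close> define an inverse; uniqueness
  makes it linear, and the lower bound is its boundedness.
\<close>

lemma zero_notin_l2_spectrumI:
  assumes T: "l2_bounded_operator T"
    and below: "\<And>f. f \<in> l2 \<Longrightarrow> l2_norm f \<le> K * l2_norm (T f)"
    and surj: "\<And>h. h \<in> l2 \<Longrightarrow> \<exists>f\<in>l2. T f = h"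
  shows "0 \<notin> l2_spectrum T"
proof -
  have T_l2: "T f \<in> l2" if "f \<in> l2" for f
    using T that unfolding l2_bounded_operator_def by blast
  have T_add: "T (\<lambda>m. f m + h m) = (\<lambda>m. T f m + T h m)" if "f \<in> l2" "h \<in> l2" for f h
    using T that unfolding l2_bounded_operator_def by blast
  have T_scale: "T (\<lambda>m. c * f m) = (\<lambda>m. c * T f m)" if "f \<in> l2" for c f
    using T that unfolding l2_bounded_operator_def by blast
  have scale_l2: "(\<lambda>m. c * f m) \<in> l2" if "f \<in> l2" for c and f :: "'a \<Rightarrow> complex"
    using that unfolding l2_def
    by (auto simp: norm_mult power_mult_distrib intro: summable_on_cmult_right)
  have inj: "f = h" if fh: "f \<in> l2" "h \<in> l2" and eq: "T f = T h" for f h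
  proof -
    have d: "(\<lambda>m. f m + (- 1) * h m) \<in> l2"
      by (intro l2_add scale_l2 fh)
    have "T (\<lambda>m. f m + (- 1) * h m) = (\<lambda>m. 0)"
      unfolding T_add[OF fh(1) scale_l2[OF fh(2)]] T_scale[OF fh(2)] eq by simp
    with below[OF d] have "l2_norm (\<lambda>m. f m + (- 1) * h m) \<le> 0"
      by (simp add: l2_norm_def)
    then have "cmod (f m + (- 1) * h m) \<le> 0" for m
      using cmod_le_l2_norm[OF d, of m] by linarith
    then show ?thesis by auto
  qed
  define S where "S h = (SOME f. f \<in> l2 \<and> T f = h)" for h
  have S: "S h \<in> l2" "T (S h) = h" if "h \<in> l2" for h
    using someI_ex[of "\<lambda>f. f \<in> l2 \<and> T f = h"] surj[OF that] unfolding S_def by auto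
  have ST: "S (T f) = f" if "f \<in> l2" for f
    by (rule inj) (simp_all add: S T_l2 that)
  have "l2_bounded_operator S"
    unfolding l2_bounded_operator_def
  proof (intro conjI ballI allI)
    show "\<exists>K. \<forall>f\<in>l2. l2_norm (S f) \<le> K * l2_norm f"
      using below[OF S(1)] S(2) by (intro exI[of _ K]) auto
  next
    fix f h :: "'a \<Rightarrow> complex" assume fh: "f \<in> l2" "h \<in> l2"
    show "S (\<lambda>m. f m + h m) = (\<lambda>m. S f m + S h m)"
      by (rule inj) (simp_all add: S T_add l2_add fh)
  next
    fix c and f :: "'a \<Rightarrow> complex" assume f: "f \<in> l2"
    show "S (\<lambda>m. c * f m) = (\<lambda>m. c * S f m)"
      by (rule inj) (simp_all add: S T_scale scale_l2 f)
  qed (rule S)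
  with S ST show ?thesis
    unfolding l2_spectrum_def by auto
qed

lemma bounded_below_if_zero_notin_l2_spectrum:
  assumes T: "l2_bounded_operator T" and "0 \<notin> l2_spectrum T"
  obtains K where "\<And>f. f \<in> l2 \<Longrightarrow> l2_norm f \<le> K * l2_norm (T f)"
proof -
  obtain S where S: "l2_bounded_operator S" and ST: "\<And>f. f \<in> l2 \<Longrightarrow> S (T f) = f"
    using assms(2) unfolding l2_spectrum_def by auto
  obtain K where "\<And>f. f \<in> l2 \<Longrightarrow> l2_norm (S f) \<le> K * l2_norm f"
    using S unfolding l2_bounded_operator_def by blast
  note K = this
  have "l2_norm f \<le> K * l2_norm (T f)" if f: "f \<in> l2" for f
  proof -
    have "T f \<in> l2" using T f unfolding l2_bounded_operator_def by blast
    from K[OF this] show ?thesis by (simp add: ST[OF f])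
  qed
  with that show thesis by blast
qed

section \<open>Operators with a dominant term\<close>

text \<open>
  The solution is the Neumann series of \<open>(I + C)\<inverse> h\<close>, where \<open>C\<close> is the sum of two weighted
  shifts and has norm at most \<open>\<alpha> + \<beta> < 1\<close>. Each value of \<open>C f\<close> involves only two values of \<open>f\<close>, so
  \<open>C\<close> commutes with the pointwise sum of the series.
\<close>

lemma perturbation_of_identity_surj:
  fixes a b :: "int \<Rightarrow> complex"
  assumes a: "\<And>m. cmod (a m) \<le> \<alpha>" and b: "\<And>m. cmod (b m) \<le> \<beta>"
    and less: "\<alpha> + \<beta> < 1" and h: "h \<in> l2"
  shows "\<exists>f\<in>l2. \<forall>m. f m + (a m * f (m + i) + b m * f (m + j)) = h m"
proof -
  define C where "C f m = a m * f (m + i) + b m * f (m + j)" for f m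
  define x where "x n = ((\<lambda>f m. - C f m) ^^ n) h" for n
  have x_0: "x 0 = h" and x_Suc: "x (Suc n) = (\<lambda>m. - C (x n) m)" for n
    by (auto simp: x_def)
  have nonneg: "0 \<le> \<alpha> + \<beta>"
    using order_trans[OF norm_ge_zero a] order_trans[OF norm_ge_zero b] by simp
  have C: "(\<lambda>m. - C f m) \<in> l2 \<and> l2_norm (\<lambda>m. - C f m) \<le> (\<alpha> + \<beta>) * l2_norm f" if f: "f \<in> l2" for f
  proof -
    have a': "cmod (- a m) \<le> \<alpha>" and b': "cmod (- b m) \<le> \<beta>" for m
      using a b by auto
    note A = l2_weighted_shift[where c = "\<lambda>m. - a m" and k = i, OF f a']
      and B = l2_weighted_shift[where c = "\<lambda>m. - b m" and k = j, OF f b']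
    have eq: "(\<lambda>m. - C f m) = (\<lambda>m. - a m * f (m + i) + - b m * f (m + j))"
      by (auto simp: C_def)
    show ?thesis
      unfolding eq using l2_add[OF A(1) B(1)] A(2) B(2) by (auto simp: algebra_simps)
  qed
  have x_l2: "x n \<in> l2" for n
    by (induction n) (use h C in \<open>auto simp: x_0 x_Suc\<close>)
  have x_norm: "l2_norm (x n) \<le> (\<alpha> + \<beta>) ^ n * l2_norm h" for n
  proof (induction n)
    case (Suc n)
    have "l2_norm (x (Suc n)) \<le> (\<alpha> + \<beta>) * l2_norm (x n)"
      unfolding x_Suc using C[OF x_l2] by blast
    also have "\<dots> \<le> (\<alpha> + \<beta>) * ((\<alpha> + \<beta>) ^ n * l2_norm h)"
      by (rule mult_left_mono[OF Suc nonneg])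
    finally show ?case by simp
  qed (simp add: x_0)
  have summ: "summable (\<lambda>n. l2_norm (x n))"
  proof (rule summable_comparison_test')
    show "summable (\<lambda>n. (\<alpha> + \<beta>) ^ n * l2_norm h)"
      using nonneg less by (intro summable_mult2 summable_geometric) simp
    show "norm (l2_norm (x n)) \<le> (\<alpha> + \<beta>) ^ n * l2_norm h" for n
      using x_norm[of n] l2_norm_nonneg[of "x n"] by simp
  qed
  note sm = l2_suminf(1)[OF x_l2 summ]
  define f where "f m = (\<Sum>n. x n m)" for m
  have "f m + C f m = h m" for m
  proof -
    have "f m = x 0 m + (\<Sum>n. x (Suc n) m)"
      unfolding f_def using suminf_split_head[OF sm] by simp
    also have "(\<Sum>n. x (Suc n) m) = - (\<Sum>n. a m * x n (m + i) + b m * x n (m + j))"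
      unfolding x_Suc C_def by (intro suminf_minus summable_add summable_mult sm)
    also have "(\<Sum>n. a m * x n (m + i) + b m * x n (m + j)) = C f m"
      unfolding C_def f_def
      by (subst suminf_add[symmetric]) (auto intro!: summable_mult sm simp: suminf_mult sm)
    finally show ?thesis by (simp add: x_0)
  qed
  moreover have "f \<in> l2"
    unfolding f_def by (rule l2_suminf(2)[OF x_l2 summ])
  ultimately show ?thesis unfolding C_def by blast
qed

text \<open>
  Dividing by the weight \<open>w\<close> and shifting by \<open>k\<close> turns \<open>T f = h\<close> into a perturbation of
  the identity whose two weights are at most \<open>\<alpha> / \<omega>\<close> and \<open>\<beta> / \<omega>\<close>. The lower bound is the triangle
  inequality; surjectivity is the Neumann series.
\<close>

lemma dominant_term_zero_notin_l2_spectrum: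
  fixes a b w :: "int \<Rightarrow> complex"
  assumes T: "l2_bounded_operator T"
    and T_eq: "\<And>f m. T f m = a m * f (m + i) + b m * f (m + j) + w m * f (m + k)"
    and a: "\<And>m. cmod (a m) \<le> \<alpha>" and b: "\<And>m. cmod (b m) \<le> \<beta>" and w: "\<And>m. \<omega> \<le> cmod (w m)"
    and less: "\<alpha> + \<beta> < \<omega>"
  shows "0 \<notin> l2_spectrum T"
proof -
  have nonneg: "0 \<le> \<alpha>" "0 \<le> \<beta>"
    using order_trans[OF norm_ge_zero a] order_trans[OF norm_ge_zero b] by auto
  then have \<omega>: "0 < \<omega>" using less by simp
  have w0: "w m \<noteq> 0" for m using w[of m] \<omega> by auto
  have quot: "cmod (c (m - k) / w (m - k)) \<le> \<gamma> / \<omega>" if "\<And>m. cmod (c m) \<le> \<gamma>" for c \<gamma> m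
    unfolding norm_divide using that[of "m - k"] w[of "m - k"] \<omega> order_trans[OF norm_ge_zero that]
    by (intro frac_le) auto
  note a' = quot[of a, OF a] and b' = quot[of b, OF b] and one' = quot[of "\<lambda>_. 1" 1]
  have eq_iff: "T f = h \<longleftrightarrow> (\<forall>m. f m + (a (m - k) / w (m - k) * f (m + (i - k)) +
      b (m - k) / w (m - k) * f (m + (j - k))) = 1 / w (m - k) * h (m + - k))" for f h
  proof -
    have "T f = h \<longleftrightarrow> (\<forall>m. T f (m - k) = h (m - k))"
      unfolding fun_eq_iff by (metis add_diff_cancel_right')
    also have "\<dots> \<longleftrightarrow> (\<forall>m. f m + (a (m - k) / w (m - k) * f (m + (i - k)) +
      b (m - k) / w (m - k) * f (m + (j - k))) = 1 / w (m - k) * h (m + - k))"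
      unfolding T_eq by (intro all_cong1) (use w0 in \<open>auto simp: field_simps\<close>)
    finally show ?thesis .
  qed
  show ?thesis
  proof (rule zero_notin_l2_spectrumI[OF T])
    fix f :: "int \<Rightarrow> complex" assume f: "f \<in> l2"
    then have Tf: "T f \<in> l2" using T unfolding l2_bounded_operator_def by blast
    have "\<And>m. cmod (- (a (m - k) / w (m - k))) \<le> \<alpha> / \<omega>" using a' by simp
    note A = l2_weighted_shift[where c = "\<lambda>m. - (a (m - k) / w (m - k))" and k = "i - k", OF f this]
    have "\<And>m. cmod (- (b (m - k) / w (m - k))) \<le> \<beta> / \<omega>" using b' by simp
    note B = l2_weighted_shift[where c = "\<lambda>m. - (b (m - k) / w (m - k))" and k = "j - k", OF f this]
    have "\<And>m. cmod (1 / w (m - k)) \<le> 1 / \<omega>" using one' by simp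
    note H = l2_weighted_shift[where c = "\<lambda>m. 1 / w (m - k)" and k = "- k", OF Tf this]
    have "f = (\<lambda>m. 1 / w (m - k) * T f (m + - k) + (- (a (m - k) / w (m - k)) * f (m + (i - k)) +
        - (b (m - k) / w (m - k)) * f (m + (j - k))))" (is "f = ?f")
      using eq_iff[of f "T f"] by (auto simp: fun_eq_iff algebra_simps)
    then have "l2_norm f = l2_norm ?f" by (rule arg_cong)
    also have "\<dots> \<le> 1 / \<omega> * l2_norm (T f) + (\<alpha> / \<omega> * l2_norm f + \<beta> / \<omega> * l2_norm f)"
      using l2_add(2)[OF H(1) l2_add(1)[OF A(1) B(1)]] l2_add(2)[OF A(1) B(1)] H(2) A(2) B(2)
      by linarith
    finally have "(\<omega> - \<alpha> - \<beta>) * l2_norm f \<le> l2_norm (T f)"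
      using \<omega> by (simp add: field_simps)
    then show "l2_norm f \<le> 1 / (\<omega> - \<alpha> - \<beta>) * l2_norm (T f)"
      using less by (simp add: field_simps)
  next
    fix h :: "int \<Rightarrow> complex" assume h: "h \<in> l2"
    have "\<And>m. cmod (1 / w (m - k)) \<le> 1 / \<omega>" using one' by simp
    note H = l2_weighted_shift(1)[where c = "\<lambda>m. 1 / w (m - k)" and k = "- k", OF h this]
    have "\<alpha> / \<omega> + \<beta> / \<omega> < 1" using less \<omega> by (simp add: field_simps)
    then show "\<exists>f\<in>l2. T f = h"
      unfolding eq_iff
      by (intro perturbation_of_identity_surj[where \<alpha> = "\<alpha> / \<omega>" and \<beta> = "\<beta> / \<omega>"] a' b' H)
  qed
qed

section \<open>Bounded solutions for other potentials\<close>

text \<open>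
  Distinct points of a finite \<open>M\<close> are separated by some \<open>\<epsilon>\<close>, so approximate matching of a pattern
  is exact matching.
\<close>

lemma pseudo_ergodic_translate:
  assumes V: "pseudo_ergodic M V" and M: "finite M" and F: "finite F" and W: "W ` F \<subseteq> M"
  obtains k where "\<And>m. m \<in> F \<Longrightarrow> V (m + k) = W m"
proof -
  obtain \<epsilon> where \<epsilon>: "\<epsilon> > 0" "\<And>x. x \<in> (\<lambda>(x, y). x - y) ` (M \<times> M) \<Longrightarrow> x \<noteq> 0 \<Longrightarrow> \<epsilon> \<le> dist 0 x"
    using finite_set_avoid[of "(\<lambda>(x, y). x - y) ` (M \<times> M)" 0] M by blast
  obtain k where k: "\<forall>m\<in>F. cmod (W m - V (m + k)) < \<epsilon>"
    using V F W \<epsilon>(1) unfolding pseudo_ergodic_def by meson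
  have "V (m + k) = W m" if "m \<in> F" for m
  proof (rule ccontr)
    assume "V (m + k) \<noteq> W m"
    moreover have "W m - V (m + k) \<in> (\<lambda>(x, y). x - y) ` (M \<times> M)"
      using V W that unfolding pseudo_ergodic_def by (intro image_eqI[of _ _ "(W m, V (m + k))"]) auto
    ultimately have "\<epsilon> \<le> cmod (W m - V (m + k))" using \<epsilon>(2) by force
    with k that show False by force
  qed
  with that show thesis by blast
qed

text \<open>
  On a finitely supported sequence \<open>hopping g W\<close> sees only finitely many values of \<open>W\<close>, and these
  occur somewhere in \<open>V\<close>. Translating \<open>f\<close> to that place makes \<open>hopping g V\<close> act on it in
  the same way, and translations preserve the norm.
\<close>

lemma lower_bound_transfer:
  assumes V: "pseudo_ergodic M V" and M: "finite M" and W: "range W \<subseteq> M"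
    and below: "\<And>h. h \<in> l2 \<Longrightarrow> l2_norm h \<le> K * l2_norm (hopping g V h)"
    and F: "finite F" and supp: "\<And>m. m \<notin> F \<Longrightarrow> f m = 0"
  shows "l2_norm f \<le> K * l2_norm (hopping g W f)"
proof -
  obtain k where k: "\<And>m. m \<in> F \<Longrightarrow> V (m + k) = W m"
    using pseudo_ergodic_translate[OF V M F, of W] W by blast
  have "V m * f (m - k) = W (m - k) * f (m - k)" for m
    using k[of "m - k"] supp[of "m - k"] by (cases "m - k \<in> F") auto
  then have eq: "hopping g V (\<lambda>m. f (m - k)) = (\<lambda>m. hopping g W f (m - k))"
    by (auto simp: hopping_def fun_eq_iff algebra_simps)
  have "(\<lambda>m. f (m - k)) \<in> l2"
    by (rule l2_finite_support[of "(\<lambda>m. m + k) ` F"])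
       (use F in \<open>auto intro!: supp simp: image_iff\<close>)
  from below[OF this] show ?thesis
    unfolding eq l2_norm_shift .
qed

text \<open>
  Let \<open>s n\<close> be the squared norm of the truncation of \<open>f\<close> to \<open>[-n, n]\<close>. The image of the truncation
  is a boundary term, so the lower bound gives \<open>s n \<le> C * (s (n + 1) - s (n - 1))\<close>. As \<open>f\<close> is
  bounded, the right-hand side is bounded; hence the increasing sequence \<open>s\<close> is bounded and
  converges. Then the right-hand side tends to 0, so the limit of \<open>s\<close> is 0.
\<close>

lemma bounded_kernel_trivial:
  assumes g: "0 \<le> g"
    and below: "\<And>F h. finite F \<Longrightarrow> (\<And>m. m \<notin> F \<Longrightarrow> h m = 0) \<Longrightarrow> l2_norm h \<le> K * l2_norm (hopping g W h)"
    and bdd: "bounded (range f)" and ker: "\<And>m. hopping g W f m = 0"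
  shows "f m = 0"
proof -
  define s where "s n = (\<Sum>m\<in>{- int n..int n}. (cmod (f m))\<^sup>2)" for n
  define C where "C = K\<^sup>2 * (exp g)\<^sup>2"
  have s_Suc: "s (Suc n) = s n + (cmod (f (int n + 1)))\<^sup>2 + (cmod (f (- int n - 1)))\<^sup>2" for n
  proof -
    have "{- int (Suc n)..int (Suc n)} = insert (int n + 1) (insert (- int n - 1) {- int n..int n})"
      by auto
    then show ?thesis by (simp add: s_def)
  qed
  have step: "s (Suc n) \<le> C * (s (Suc (Suc n)) - s n)" for n
  proof -
    define N where "N = int n + 1"
    define h where "h m = (if m \<in> {- N..N} then f m else 0)" for m
    define D where "D = {N, N + 1, - N, - N - 1}"
    have N: "1 \<le> N" by (simp add: N_def)
    have h_norm: "l2_norm h = sqrt (s (Suc n))"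
      by (subst l2_norm_finite_support[of "{- N..N}"]) (auto simp: h_def s_def N_def algebra_simps)
    have Hh: "hopping g W h m = 0" if "m \<notin> D" for m
    proof (cases "m \<in> {- N<..<N}")
      case True
      then have "hopping g W h m = hopping g W f m" by (auto simp: hopping_def h_def)
      then show ?thesis by (simp add: ker)
    next
      case False
      then show ?thesis using that by (auto simp: hopping_def h_def D_def)
    qed
    have eg: "exp (- g) \<le> exp g" using g by simp
    \<comment> \<open>The two terms of the equation at \<open>\<plusminus>N\<close> that the truncation keeps are minus the one it drops.\<close>
    have right: "exp (- g) * f (N - 1) + W N * f N = - (exp g * f (N + 1))"
      using ker[of N] by (simp add: hopping_def eq_neg_iff_add_eq_0 algebra_simps)
    have left: "exp g * f (- N + 1) + W (- N) * f (- N) = - (exp (- g) * f (- N - 1))"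
      using ker[of "- N"] by (simp add: hopping_def eq_neg_iff_add_eq_0 algebra_simps)
    have vals: "cmod (hopping g W h N) = exp g * cmod (f (N + 1))"
      "cmod (hopping g W h (N + 1)) = exp (- g) * cmod (f N)"
      "cmod (hopping g W h (- N)) = exp (- g) * cmod (f (- N - 1))"
      "cmod (hopping g W h (- N - 1)) = exp g * cmod (f (- N))"
      using N left right by (simp_all add: hopping_def h_def norm_mult)
    have le: "(exp (- g) * x)\<^sup>2 \<le> (exp g)\<^sup>2 * x\<^sup>2" for x
      unfolding power_mult_distrib using eg by (intro mult_right_mono power_mono) auto
    have "(l2_norm (hopping g W h))\<^sup>2 = (\<Sum>m\<in>D. (cmod (hopping g W h m))\<^sup>2)"
      by (subst l2_norm_finite_support[of D]) (auto simp: Hh sum_nonneg, auto simp: D_def)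
    also have "\<dots> = (exp g * cmod (f (N + 1)))\<^sup>2 + (exp (- g) * cmod (f N))\<^sup>2 +
        (exp (- g) * cmod (f (- N - 1)))\<^sup>2 + (exp g * cmod (f (- N)))\<^sup>2"
      unfolding vals[symmetric] using N by (simp add: D_def)
    also have "\<dots> \<le> (exp g)\<^sup>2 * ((cmod (f (N + 1)))\<^sup>2 + (cmod (f N))\<^sup>2 +
        (cmod (f (- N - 1)))\<^sup>2 + (cmod (f (- N)))\<^sup>2)"
      using le[of "cmod (f N)"] le[of "cmod (f (- N - 1))"]
      by (simp add: power_mult_distrib algebra_simps)
    also have "\<dots> = (exp g)\<^sup>2 * (s (Suc (Suc n)) - s n)"
      unfolding s_Suc by (simp add: N_def algebra_simps minus_diff_commute)
    finally have H_norm: "(l2_norm (hopping g W h))\<^sup>2 \<le> (exp g)\<^sup>2 * (s (Suc (Suc n)) - s n)" .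
    have "l2_norm h \<le> K * l2_norm (hopping g W h)"
      by (rule below[of "{- N..N}"]) (auto simp: h_def)
    then have "(l2_norm h)\<^sup>2 \<le> (K * l2_norm (hopping g W h))\<^sup>2"
      by (rule power_mono) (rule l2_norm_nonneg)
    also have "\<dots> \<le> K\<^sup>2 * ((exp g)\<^sup>2 * (s (Suc (Suc n)) - s n))"
      unfolding power_mult_distrib by (rule mult_left_mono[OF H_norm]) simp
    finally show ?thesis
      unfolding h_norm C_def by (simp add: s_def sum_nonneg algebra_simps)
  qed
  have mono: "incseq s"
    by (rule incseq_SucI) (simp add: s_Suc)
  obtain B where B: "\<And>m. cmod (f m) \<le> B"
    using bdd by (auto simp: bounded_iff)
  have f_sq: "(cmod (f m))\<^sup>2 \<le> B\<^sup>2" for m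
    by (rule power_mono[OF B]) simp
  have "s n \<le> C * (4 * B\<^sup>2)" for n
  proof -
    have "s n \<le> s (Suc n)" using mono by (simp add: incseq_SucD)
    also have "\<dots> \<le> C * (s (Suc (Suc n)) - s n)" by (rule step)
    also have "\<dots> \<le> C * (4 * B\<^sup>2)"
    proof (rule mult_left_mono)
      show "s (Suc (Suc n)) - s n \<le> 4 * B\<^sup>2"
        unfolding s_Suc
        using f_sq[of "int n + 1"] f_sq[of "- int n - 1"] f_sq[of "int (Suc n) + 1"]
          f_sq[of "- int (Suc n) - 1"] by linarith
    qed (simp add: C_def)
    finally show ?thesis .
  qed
  then obtain L where L: "s \<longlonglongrightarrow> L" and s_le: "\<And>n. s n \<le> L"
    using incseq_convergent[OF mono] by blast
  have "(\<lambda>n. C * (s (Suc (Suc n)) - s n)) \<longlonglongrightarrow> C * (L - L)"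
    by (intro tendsto_intros L LIMSEQ_Suc)
  from LIMSEQ_le[OF LIMSEQ_Suc[OF L] this] step have "L \<le> 0" by auto
  then have "s (nat \<bar>m\<bar>) \<le> 0" using s_le order_trans by blast
  moreover have "(cmod (f m))\<^sup>2 \<le> s (nat \<bar>m\<bar>)"
    unfolding s_def by (rule member_le_sum) auto
  ultimately have "(cmod (f m))\<^sup>2 \<le> 0" by linarith
  then show ?thesis by simp
qed

section \<open>A potential with a bounded null solution\<close>

fun recurrence :: "real \<Rightarrow> real \<Rightarrow> real \<Rightarrow> real \<Rightarrow> nat \<Rightarrow> real" where
  "recurrence a d x y 0 = x"
| "recurrence a d x y (Suc 0) = y"
| "recurrence a d x y (Suc (Suc n)) = - a * recurrence a d x y (Suc n) - d * recurrence a d x y n"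

text \<open>
  With \<open>c = a / (1 + d) < 1\<close>, the quadratic form \<open>x\<^sup>2 + y\<^sup>2 + 2 c x y\<close> of two consecutive
  terms is positive definite and does not increase along the recurrence. This covers real, double
  and complex characteristic roots at once. For \<open>c = 1\<close> the form would degenerate.
\<close>

lemma recurrence_bounded:
  assumes a: "0 \<le> a" "a < 1 + d" and d: "0 \<le> d" "d \<le> 1"
  shows "\<exists>B. \<forall>n. \<bar>recurrence a d x y n\<bar> \<le> B"
proof -
  define c where "c = a / (1 + d)"
  have c: "0 \<le> c" "c < 1" using a d by (auto simp: c_def)
  have ca: "a = c * (1 + d)" using d by (simp add: c_def)
  define Q where "Q x y = x\<^sup>2 + y\<^sup>2 + 2 * c * (x * y)" for x y :: real
  let ?r = "recurrence a d x y"
  have Q_step: "Q y (- a * y - d * x) \<le> Q x y" for x y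
  proof -
    have "Q x y - Q y (- a * y - d * x) = (1 - d) * (1 + d) * (c * y + x)\<^sup>2"
      unfolding Q_def ca by (simp add: power2_eq_square algebra_simps)
    moreover have "0 \<le> (1 - d) * (1 + d) * (c * y + x)\<^sup>2" using d by simp
    ultimately show ?thesis by linarith
  qed
  have Q_le: "Q (?r n) (?r (Suc n)) \<le> Q x y" for n
  proof (induction n)
    case (Suc n)
    show ?case using Q_step[of "?r (Suc n)" "?r n"] Suc by simp
  qed simp
  have Q_ge: "(1 - c) * x\<^sup>2 \<le> Q x y" for x y
  proof -
    have "Q x y - (1 - c) * x\<^sup>2 = c * (x + y)\<^sup>2 + (1 - c) * y\<^sup>2"
      unfolding Q_def by (simp add: power2_eq_square algebra_simps)
    moreover have "0 \<le> c * (x + y)\<^sup>2 + (1 - c) * y\<^sup>2" using c by simp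
    ultimately show ?thesis by linarith
  qed
  have "\<bar>?r n\<bar> \<le> sqrt (Q x y / (1 - c))" for n
  proof -
    have "(1 - c) * (?r n)\<^sup>2 \<le> Q x y" using Q_ge Q_le order_trans by blast
    then have "(?r n)\<^sup>2 \<le> Q x y / (1 - c)" using c by (simp add: field_simps)
    then show ?thesis using real_sqrt_le_mono by fastforce
  qed
  then show ?thesis by blast
qed

text \<open>
  On the left the solution is \<open>\<sigma> m * \<rho>^m\<close> with the sign pattern \<open>+ + - -\<close> of period 4. For this
  pattern \<open>\<sigma> (m - 1) = - \<sigma> (m + 1)\<close>, so the equation becomes \<open>E * \<rho>\<^sup>2 = \<mu> * \<rho> + e\<close> once the
  potential is \<open>- \<sigma> m * \<sigma> (m + 1) * \<mu>\<close>, which alternates in sign. The positive root \<open>\<rho>\<close> satisfies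
  \<open>\<rho> \<ge> 1\<close> because \<open>\<mu> \<ge> E - e\<close>, so the solution is bounded for \<open>m \<le> 1\<close>. Its values at 0 and 1
  are the initial values of the recurrence that continues it to the right.
\<close>

lemma bounded_null_solution:
  fixes E e \<mu> :: real
  assumes Ee: "0 < e" "e \<le> E" and \<mu>: "0 \<le> \<mu>" "E - e \<le> \<mu>" "\<mu> \<le> E + e"
  obtains w u :: "int \<Rightarrow> real" and B :: real
  where "\<And>m. w m \<in> {\<mu>, - \<mu>}" and "\<And>m. \<bar>u m\<bar> \<le> B" and "u 0 = 1"
    and "\<And>m. e * u (m - 1) + E * u (m + 1) + w m * u m = 0"
proof (cases "\<mu> = E + e")
  case True
  show thesis
  proof (rule that[of "\<lambda>_. \<mu>" "\<lambda>m. if even m then 1 else - 1" 1])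
    show "e * (if even (m - 1) then 1 else - 1) + E * (if even (m + 1) then 1 else - 1) +
        \<mu> * (if even m then 1 else - 1) = 0" for m :: int
      using True by (cases "even m") auto
  qed auto
next
  case False
  define \<rho> where "\<rho> = (\<mu> + sqrt (\<mu>\<^sup>2 + 4 * E * e)) / (2 * E)"
  have E: "0 < E" using Ee by simp
  have sq: "(sqrt (\<mu>\<^sup>2 + 4 * E * e))\<^sup>2 = \<mu>\<^sup>2 + 4 * E * e"
    using E Ee by (intro real_sqrt_pow2) (auto intro!: add_nonneg_nonneg)
  have "2 * E * \<rho> - \<mu> = sqrt (\<mu>\<^sup>2 + 4 * E * e)"
    using E by (simp add: \<rho>_def)
  then have "(2 * E * \<rho> - \<mu>)\<^sup>2 = \<mu>\<^sup>2 + 4 * E * e" using sq by simp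
  then have "4 * E * (E * \<rho>\<^sup>2) = 4 * E * (\<mu> * \<rho> + e)"
    by (simp add: power2_eq_square algebra_simps)
  then have \<rho>_eq: "E * \<rho>\<^sup>2 = \<mu> * \<rho> + e" using E by simp
  \<comment> \<open>By the formula for \<open>\<rho>\<close>, \<open>1 \<le> \<rho>\<close> says that the square root is at least \<open>2 * E - \<mu>\<close>.\<close>
  have "(2 * E - \<mu>)\<^sup>2 \<le> \<mu>\<^sup>2 + 4 * E * e"
  proof -
    have "E * (E - e) \<le> E * \<mu>" using \<mu> E by (intro mult_left_mono) auto
    then show ?thesis by (simp add: power2_eq_square algebra_simps)
  qed
  then have "2 * E - \<mu> \<le> sqrt (\<mu>\<^sup>2 + 4 * E * e)" by (rule real_le_rsqrt)
  then have \<rho>1: "1 \<le> \<rho>" using E by (simp add: \<rho>_def field_simps)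
  define \<sigma> :: "int \<Rightarrow> real" where "\<sigma> m = (if m mod 4 < 2 then 1 else - 1)" for m
  have \<sigma>_anti: "\<sigma> (m - 1) = - \<sigma> (m + 1)" for m
  proof -
    have "(m - 1) mod 4 < 2 \<longleftrightarrow> \<not> (m + 1) mod 4 < 2" by presburger
    then show ?thesis by (simp add: \<sigma>_def)
  qed
  have \<sigma>_sq: "\<sigma> m * \<sigma> m = 1" and \<sigma>_abs: "\<bar>\<sigma> m\<bar> = 1" and \<sigma>_cases: "\<sigma> m = 1 \<or> \<sigma> m = - 1" for m
    by (auto simp: \<sigma>_def)
  define r where "r = recurrence (\<mu> / E) (e / E) 1 \<rho>"
  obtain B where B: "\<And>n. \<bar>r n\<bar> \<le> B"
    using recurrence_bounded[of "\<mu> / E" "e / E" 1 \<rho>] False E Ee \<mu>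
    unfolding r_def by (auto simp: field_simps)
  define u where "u m = (if m \<le> 1 then \<sigma> m * \<rho> powi m else r (nat m))" for m
  \<comment> \<open>The two branches agree at 0 and 1, so the equation at \<open>m \<le> 0\<close> involves only the left branch
    and the equation at \<open>m \<ge> 1\<close> only the right one.\<close>
  have u_right: "u (int n) = r n" for n
  proof -
    consider "n = 0" | "n = 1" | "2 \<le> n" by linarith
    then show ?thesis by cases (auto simp: u_def r_def \<sigma>_def)
  qed
  define w where "w m = (if m \<le> 0 then - (\<sigma> m * \<sigma> (m + 1) * \<mu>) else \<mu>)" for m
  have B1: "1 \<le> B" using B[of 0] by (simp add: r_def)
  show thesis
  proof (rule that[of w u B])
    show "w m \<in> {\<mu>, - \<mu>}" for m
      using \<sigma>_cases[of m] \<sigma>_cases[of "m + 1"] by (auto simp: w_def)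
    show "u 0 = 1" by (simp add: u_def \<sigma>_def)
    show "\<bar>u m\<bar> \<le> B" for m
    proof (cases "m \<le> 0")
      case True
      then have "\<rho> powi m = inverse (\<rho> ^ nat (- m))"
        by (cases "m = 0") (auto simp: power_int_def power_inverse)
      then have "\<bar>u m\<bar> \<le> 1"
        using \<rho>1 True by (simp add: u_def abs_mult \<sigma>_abs inverse_le_1_iff one_le_power)
      with B1 show ?thesis by simp
    next
      case False
      then show ?thesis using u_right[of "nat m"] B by simp
    qed
    show "e * u (m - 1) + E * u (m + 1) + w m * u m = 0" for m
    proof (cases "m \<le> 0")
      case True
      define p where "p = \<rho> powi (m - 1)"
      have p: "\<rho> powi m = \<rho> * p" "\<rho> powi (m + 1) = \<rho>\<^sup>2 * p"
        using \<rho>1 power_int_add_1[of \<rho> "m - 1"] power_int_add_1[of \<rho> m]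
        by (auto simp: p_def power2_eq_square)
      have vals: "u (m - 1) = - \<sigma> (m + 1) * p" "u m = \<sigma> m * (\<rho> * p)"
        "u (m + 1) = \<sigma> (m + 1) * (\<rho>\<^sup>2 * p)" "w m = - (\<sigma> m * \<sigma> (m + 1) * \<mu>)"
        using True by (simp_all only: u_def w_def p \<sigma>_anti p_def) auto
      have "e * u (m - 1) + E * u (m + 1) + w m * u m =
          \<sigma> (m + 1) * p * (E * \<rho>\<^sup>2 - e - \<sigma> m * \<sigma> m * \<mu> * \<rho>)"
        unfolding vals by (simp add: algebra_simps)
      also have "\<dots> = 0" unfolding \<sigma>_sq \<rho>_eq by simp
      finally show ?thesis .
    next
      case False
      define n where "n = nat (m - 1)"
      have "m - 1 = int n" "m = int (Suc n)" "m + 1 = int (Suc (Suc n))"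
        using False by (auto simp: n_def)
      then have "u (m - 1) = r n" "u m = r (Suc n)" "u (m + 1) = r (Suc (Suc n))"
        by (simp_all only: u_right)
      then show ?thesis using False E by (simp add: w_def r_def field_simps)
    qed
  qed
qed

theorem corollary15:
  fixes g \<mu> :: real and V :: "int \<Rightarrow> complex"
  assumes "g > 0" and "\<mu> \<ge> 0"
    and "pseudo_ergodic {of_real \<mu>, - of_real \<mu>} V"
  shows "0 \<in> l2_spectrum (hopping g V) \<longleftrightarrow>
    exp g - exp (- g) \<le> \<mu> \<and> \<mu> \<le> exp g + exp (- g)"
proof
  have V: "V m \<in> {of_real \<mu>, - of_real \<mu>}" for m
    using assms(3) unfolding pseudo_ergodic_def by blast
  then have cV: "cmod (V m) = \<mu>" for m
    using assms(2) V[of m] by (elim insertE emptyE) simp_all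
  then have op: "l2_bounded_operator (hopping g V)"
    by (intro l2_bounded_operator_hopping) (auto simp: bounded_iff)
  {
    assume spec: "0 \<in> l2_spectrum (hopping g V)"
    show "exp g - exp (- g) \<le> \<mu> \<and> \<mu> \<le> exp g + exp (- g)"
    proof (rule ccontr)
      assume "\<not> (exp g - exp (- g) \<le> \<mu> \<and> \<mu> \<le> exp g + exp (- g))"
      then consider "exp (- g) + \<mu> < exp g" | "exp (- g) + exp g < \<mu>" by linarith
      then have "0 \<notin> l2_spectrum (hopping g V)"
      proof cases
        case 1
        show ?thesis
          by (rule dominant_term_zero_notin_l2_spectrum[OF op, where i = "- 1" and j = 0 and k = 1
                and a = "\<lambda>_. of_real (exp (- g))" and b = V and w = "\<lambda>_. of_real (exp g)", OF _ _ _ _ 1])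
             (auto simp: hopping_def cV)
      next
        case 2
        show ?thesis
          by (rule dominant_term_zero_notin_l2_spectrum[OF op, where i = "- 1" and j = 1 and k = 0
                and a = "\<lambda>_. of_real (exp (- g))" and b = "\<lambda>_. of_real (exp g)" and w = V, OF _ _ _ _ 2])
             (auto simp: hopping_def cV)
      qed
      with spec show False by contradiction
    qed
  }
  assume \<mu>: "exp g - exp (- g) \<le> \<mu> \<and> \<mu> \<le> exp g + exp (- g)"
  show "0 \<in> l2_spectrum (hopping g V)"
  proof (rule ccontr)
    assume "0 \<notin> l2_spectrum (hopping g V)"
    then obtain K where K: "\<And>f. f \<in> l2 \<Longrightarrow> l2_norm f \<le> K * l2_norm (hopping g V f)"
      using bounded_below_if_zero_notin_l2_spectrum[OF op] by blast
    have le: "exp (- g) \<le> exp g" using assms(1) by simp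
    obtain w u :: "int \<Rightarrow> real" and B where w: "\<And>m. w m \<in> {\<mu>, - \<mu>}" and u: "\<And>m. \<bar>u m\<bar> \<le> B" "u 0 = 1"
      and eq: "\<And>m. exp (- g) * u (m - 1) + exp g * u (m + 1) + w m * u m = 0"
      using bounded_null_solution[OF exp_gt_zero le assms(2) conjunct1[OF \<mu>] conjunct2[OF \<mu>]]
      by metis
    define W f where "W m = complex_of_real (w m)" and "f m = complex_of_real (u m)" for m
    have W: "range W \<subseteq> {of_real \<mu>, - of_real \<mu>}"
      using w by (fastforce simp: W_def)
    have bdd: "bounded (range f)"
      using u(1) by (auto simp: bounded_iff f_def)
    have ker: "hopping g W f m = 0" for m
    proof -
      have "hopping g W f m = of_real (exp (- g) * u (m - 1) + exp g * u (m + 1) + w m * u m)"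
        by (simp add: hopping_def W_def f_def)
      then show ?thesis by (simp only: eq of_real_0)
    qed
    have "f 0 = 0"
      by (rule bounded_kernel_trivial[OF _ lower_bound_transfer[OF assms(3) _ W K] bdd ker])
         (use assms(1) in auto)
    then show False using u(2) by (simp add: f_def)
  qed
qed

end
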